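(* Fix $\varepsilon>0$, $\tau_1>0$, $\tau_2\ge0$, $\delta>0$, and let $u^\varepsilon\in U$ be the solution of the fine-scale problem (see context). Assume: (i) (Fine-scale stability) there are $C_s^\varepsilon,C_b^\varepsilon>0$ with $C_s^\varepsilon\lVert u\rVert_V^2\le\lVert\mathcal{A}^\varepsilon u\rVert_H^2+\lVert\mathcal{B}u\rVert_Z^2\le C_b^\varepsilon\lVert u\rVert_U^2$ for all $u\in U$; (ii) (Coarse-scale stability) there is $\bar r^\varepsilon>0$ such that, with $B_{\bar r^\varepsilon}(u^\varepsilon)=\{v\in U:\lVert u^\varepsilon-v\rVert_U\le\bar r^\varepsilon\}$, there are constants $c_1,c_2>0$ (independent of $u$, possibly dependent on $\varepsilon$) with $b_{\mathcal{L}}[u](v,w)\le c_1\lVert v\rVert_Y\lVert w\rVert_Y$ and $b_{\mathcal{L}}[u](v,v)\ge c_2\lVert v\rVert_Y^2$ for all $v,w\in Y$ and all $u\in B_{\bar r^\varepsilon}(u^\varepsilon)$; (iii) (Neural network approximation) the neural network classes satisfy $\mathfrak{N}_{\theta,n}\subset X$ and $\mathfrak{N}_{\theta,n}\subset\mathfrak{N}_{\theta,n+1}$ for all $n\in\mathbb{N}$, $X\subset\overline{\bigcup_n\mathfrak{N}_{\theta,n}}$ in the topology of $(X,\lVert\cdot\rVert_X)$, and $\mathcal{A}^\varepsilon v\in L^2(\Omega)$, $\mathcal{B}v\in L^2(\partial\Omega)$ for all $v\in\mathfrak{N}_{\theta,n}$; (iv) (Continuity) for every approximating sequence $\{u_k^\varepsilon\}\subset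 B_{\bar r^\varepsilon}(u^\varepsilon)\cap X$ of $u^\varepsilon$ (see context), $S(u_k^\varepsilon)\rightharpoonup S(u^\varepsilon)$ weakly in $Y$ as $k\to\infty$. Let $n_\varepsilon^*\in\mathbb{N}$ be such that $B_{\bar r^\varepsilon,\theta,n}(u^\varepsilon):=B_{\bar r^\varepsilon}(u^\varepsilon)\cap\mathfrak{N}_{\theta,n}\neq\emptyset$ for all $n\ge n_\varepsilon^*$, and let $\{u^\varepsilon_{\boldsymbol\theta,n}\}_{n\ge n_\varepsilon^*}$, $u^\varepsilon_{\boldsymbol\theta,n}\in B_{\bar r^\varepsilon,\theta,n}(u^\varepsilon)$, be a quasi-minimizing sequence for $\widehat J$, i.e. for some $\gamma_n>0$ with $\gamma_n\downarrow0$, $$\widehat J(u^\varepsilon_{\boldsymbol\theta,n})\le\inf_{v\in B_{\bar r^\varepsilon,\theta,n}(u^\varepsilon)}\widehat J(v)+\gamma_n\qquad\text{for all }n\ge n_\varepsilon^*.$$ Then $$\lim_{n\to\infty}\widehat J(u^\varepsilon_{\boldsymbol\theta,n})\le\tau_2\,\mathcal{R}_\delta(y(u^\varepsilon),u^\varepsilon),$$ and, moreover, for $\tau_1\ge1$ it holds that $$\lim_{n\to\infty}\lVert u^\varepsilon_{\boldsymbol\theta,n}-u^\varepsilon\rVert_V\le\frac1{\sqrt{C_s^\varepsilon}}\sqrt{\tau_2\,\mathcal{R}_\delta(y(u^\varepsilon),u^\varepsilon)} .$$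
   Context: $\Omega\subset\mathbb{R}^d$ is a bounded Lipschitz domain. $U$ and $H=L^2(\Omega)$ are Hilbert spaces, $V,Z$ Banach spaces, with continuous embeddings $U\hookrightarrow V\hookrightarrow H$; $X$ is a normed space that is a dense subspace of $U$ with continuous embedding $X\hookrightarrow U$. $Y$ is a Hilbert space with $U_0:=\{u\in U:\mathcal{B}u=0\}\subseteq Y$, and $Y\hookrightarrow H\cong H^*\hookrightarrow Y^*$ is a Gelfand triple with compact embedding $Y\hookrightarrow H$. $L(A,B)$ denotes bounded linear operators. Fine-scale problem: $\mathcal{A}^\varepsilon u=f^\varepsilon$ in $H$, $\mathcal{B}u=0$ in $Z$, with $\mathcal{A}^\varepsilon\in L(U,H)$, $\mathcal{B}\in L(U,Z)$, $f^\varepsilon\in H$. Standing assumption: it has a unique solution $u^\varepsilon\in U$, and $u^\varepsilon$ admits an approximating sequence, meaning a sequence $\{u_k^\varepsilon\}\subset X$ with $\lVert u_k^\varepsilon-u^\varepsilon\rVert_U\to0$ and $\lVert\mathcal{A}^\varepsilon u_k^\varepsilon-f^\varepsilon\rVert_H+\lVert\mathcal{B}u_k^\varepsilon\rVert_Z\to0$ as $k\to\infty$. Coarse-scale problem: for $u\in U$ an operator $\mathcal{L}[u]\in L(Y,Y^* )$ is given, $b_{\mathcal{L}}[u](v,w):=\langle\mathcal{L}[u]v,w\rangle_{Y^*,Y}$, and $\tilde f\in H$ is given. For $u\in B_{\bar r^\varepsilon}(u^\varepsilon)$, $y(u)=S(u)\in Y$ denotes the (by Lax–Milgram unique) solution of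 $b_{\mathcal{L}}[u](y(u),v)=\langle\tilde f,v\rangle_{Y^*,Y}$ for all $v\in Y$; $S$ is called the fine-to-coarse scale map. Neural network classes: $\{\mathfrak{N}_{\theta,n}\}_{n}$ is a sequence of sets of realizations of feed-forward neural networks $R_{\boldsymbol\theta}(x)=z^L(x)$, $z^l=W^l\sigma(z^{l-1})+b^l$ ($2\le l\le L$), $z^1=W^1x+b^1$, with activation $\sigma:\mathbb{R}\to\mathbb{R}$ applied componentwise; $\mathfrak{N}_{\theta,n}$ contains all such networks whose architecture vector (of layer widths) is componentwise bounded by a prescribed architecture $\vec{\boldsymbol n}_n$, with $\vec{\boldsymbol n}_n\le\vec{\boldsymbol n}_{n+1}$. Compression operator: for $\delta>0$, $\Omega_\delta:=\{z\in\Omega:\mathrm{dist}(z,\partial\Omega)>\delta/2\}$, $\mathcal{V}_\delta(x)=\{z:|z-x|\le\delta/2\}$; for $v\in H$, $(\bar Q_\delta v)(x)=\frac1{|\mathcal{V}_\delta(x)|}\int_{\mathcal{V}_\delta(x)}v\,dz$ if $x\in\Omega_\delta$, and $(\bar Q_\delta v)(x)=v(x)$ if $x\in\Omega\setminus\Omega_\delta$. Functionals: $\mathcal{R}_\delta(y,v)=\lVert\bar Q_\delta v-\bar Q_\delta y\rVert_H^2$, $\mathcal{J}(v)=\lVert\mathcal{A}^\varepsilon v-f^\varepsilon\rVert_H^2+\tau_1\lVert\mathcal{B}v\rVert_Z^2$, $J(y,v)=\mathcal{J}(v)+\tau_2\mathcal{R}_\delta(y,v)$, and the reduced functional is $\widehat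 J(v)=J(S(v),v)$ for $v\in B_{\bar r^\varepsilon}(u^\varepsilon)$.
   Formalization: The limit in the second conclusion (the V-norm error bound for τ₁ ≥ 1) is stated as a limit superior, because the hypotheses do not ensure that the V-norm errors converge; the bound is unchanged and holds for the limit whenever it exists. *)

theory Defs
  imports "HOL-Analysis.Analysis"
begin

section \<open>The Hilbert space of square integrable functions\<close>

definition square_integrable :: "'a measure \<Rightarrow> ('a \<Rightarrow> real) \<Rightarrow> bool" where
  "square_integrable M f \<longleftrightarrow> f \<in> borel_measurable M \<and> integrable M (\<lambda>x. (f x)\<^sup>2)"

lemma square_integrable_zero: "square_integrable M (\<lambda>x. 0)"
  by (simp add: square_integrable_def)

lemma square_integrable_mult:
  assumes "square_integrable M f" "square_integrable M g"
  shows "integrable M (\<lambda>x. f x * g x)"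
proof (rule Bochner_Integration.integrable_bound)
  show "integrable M (\<lambda>x. (f x)\<^sup>2 + (g x)\<^sup>2)"
    using assms by (auto simp: square_integrable_def)
  show "(\<lambda>x. f x * g x) \<in> borel_measurable M"
    using assms by (auto simp: square_integrable_def)
  show "AE x in M. norm (f x * g x) \<le> norm ((f x)\<^sup>2 + (g x)\<^sup>2)"
  proof (rule AE_I2)
    fix x
    have "2 * \<bar>f x\<bar> * \<bar>g x\<bar> \<le> (f x)\<^sup>2 + (g x)\<^sup>2"
      using sum_squares_bound[of "\<bar>f x\<bar>" "\<bar>g x\<bar>"] by simp
    moreover have "0 \<le> \<bar>f x\<bar> * \<bar>g x\<bar>"
      by simp
    ultimately have "\<bar>f x\<bar> * \<bar>g x\<bar> \<le> (f x)\<^sup>2 + (g x)\<^sup>2"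
      by linarith
    then show "norm (f x * g x) \<le> norm ((f x)\<^sup>2 + (g x)\<^sup>2)"
      by (simp add: abs_mult)
  qed
qed

lemma square_integrable_add:
  assumes "square_integrable M f" "square_integrable M g"
  shows "square_integrable M (\<lambda>x. f x + g x)"
proof -
  have "integrable M (\<lambda>x. (f x)\<^sup>2 + (g x)\<^sup>2 + 2 * (f x * g x))"
    using assms square_integrable_mult[OF assms]
    by (intro Bochner_Integration.integrable_add integrable_mult_right)
      (auto simp: square_integrable_def)
  then have "integrable M (\<lambda>x. (f x + g x)\<^sup>2)"
    by (simp add: power2_sum mult.assoc)
  then show ?thesis
    using assms by (auto simp: square_integrable_def)
qed

lemma square_integrable_scale:
  assumes "square_integrable M f"
  shows "square_integrable M (\<lambda>x. c * f x)"
  using assms by (auto simp: square_integrable_def power_mult_distrib)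

quotient_type (overloaded) 'a L2 = "'a::euclidean_space \<Rightarrow> real" / partial:
  "\<lambda>f g. square_integrable lebesgue f \<and> square_integrable lebesgue g \<and>
     (AE x in lebesgue. f x = g x)"
proof (rule part_equivpI)
  show "\<exists>f::'a \<Rightarrow> real. square_integrable lebesgue f \<and> square_integrable lebesgue f \<and>
      (AE x in lebesgue. f x = f x)"
    using square_integrable_zero by (intro exI[of _ "\<lambda>_. 0"]) auto
qed (auto intro!: sympI transpI)

instantiation L2 :: (euclidean_space) real_inner
begin

lift_definition zero_L2 :: "'a L2" is "\<lambda>x. 0"
  by (simp add: square_integrable_zero)

lift_definition plus_L2 :: "'a L2 \<Rightarrow> 'a L2 \<Rightarrow> 'a L2" is "\<lambda>f g x. f x + g x"
  by (auto intro: square_integrable_add)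

lift_definition uminus_L2 :: "'a L2 \<Rightarrow> 'a L2" is "\<lambda>f x. - f x"
  by (auto dest: square_integrable_scale[where c = "-1"])

definition minus_L2 :: "'a L2 \<Rightarrow> 'a L2 \<Rightarrow> 'a L2" where
  "minus_L2 f g = f + - g"

lift_definition scaleR_L2 :: "real \<Rightarrow> 'a L2 \<Rightarrow> 'a L2" is "\<lambda>c f x. c * f x"
  by (auto intro: square_integrable_scale)

lift_definition inner_L2 :: "'a L2 \<Rightarrow> 'a L2 \<Rightarrow> real" is
  "\<lambda>f g. \<integral>x. f x * g x \<partial>lebesgue"
  by (rule integral_cong_AE) (auto simp: square_integrable_def)

definition norm_L2 :: "'a L2 \<Rightarrow> real" where
  "norm_L2 f = sqrt (inner f f)"

definition sgn_L2 :: "'a L2 \<Rightarrow> 'a L2" where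
  "sgn_L2 f = inverse (norm f) *\<^sub>R f"

definition dist_L2 :: "'a L2 \<Rightarrow> 'a L2 \<Rightarrow> real" where
  "dist_L2 f g = norm (f - g)"

definition uniformity_L2 :: "('a L2 \<times> 'a L2) filter" where
  "uniformity_L2 = (INF e\<in>{0 <..}. principal {(f, g). dist f g < e})"

definition open_L2 :: "'a L2 set \<Rightarrow> bool" where
  "open_L2 S \<longleftrightarrow> (\<forall>f\<in>S. \<forall>\<^sub>F (f', g) in uniformity. f' = f \<longrightarrow> g \<in> S)"

instance
proof
  fix f g h :: "'a L2" and a b :: real and S :: "'a L2 set"
  show "f + g + h = f + (g + h)"
    by transfer (auto intro: square_integrable_add simp: add.assoc)
  show "f + g = g + f"
    by transfer (auto intro: square_integrable_add)
  show "0 + f = f"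
    by transfer auto
  show "- f + f = 0"
    by transfer (auto simp: square_integrable_zero)
  show "f - g = f + - g"
    by (simp add: minus_L2_def)
  show "a *\<^sub>R (f + g) = a *\<^sub>R f + a *\<^sub>R g"
    by transfer (auto intro!: square_integrable_add square_integrable_scale simp: distrib_left)
  show "(a + b) *\<^sub>R f = a *\<^sub>R f + b *\<^sub>R f"
    by transfer (auto intro!: square_integrable_add square_integrable_scale simp: distrib_right)
  show "a *\<^sub>R b *\<^sub>R f = (a * b) *\<^sub>R f"
    by transfer (auto intro: square_integrable_scale simp: mult.assoc)
  show "1 *\<^sub>R f = f"
    by transfer auto
  show "inner f g = inner g f"
    by transfer (simp add: mult.commute)
  show "inner (f + g) h = inner f h + inner g h"
    by transfer (auto simp: distrib_right square_integrable_mult)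
  show "inner (a *\<^sub>R f) g = a * inner f g"
    by transfer (auto simp: mult.assoc)
  show "0 \<le> inner f f"
    by transfer auto
  show "inner f f = 0 \<longleftrightarrow> f = 0"
  proof transfer
    fix f :: "'a \<Rightarrow> real"
    assume f: "square_integrable lebesgue f \<and> square_integrable lebesgue f \<and>
      (AE x in lebesgue. f x = f x)"
    then have "(\<integral>x. f x * f x \<partial>lebesgue) = 0 \<longleftrightarrow> (AE x in lebesgue. f x * f x = 0)"
      by (intro integral_nonneg_eq_0_iff_AE) (auto intro: square_integrable_mult)
    then show "(\<integral>x. f x * f x \<partial>lebesgue) = 0 \<longleftrightarrow>
        (square_integrable lebesgue f \<and> square_integrable lebesgue (\<lambda>x::'a. 0::real) \<and>
          (AE x in lebesgue. f x = 0))"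
      using f by (simp add: square_integrable_zero)
  qed
qed (simp_all add: norm_L2_def sgn_L2_def dist_L2_def uniformity_L2_def open_L2_def)

end

text \<open>
  \<open>L2_on \<Omega>\<close> is the space of square integrable functions on \<open>\<Omega>\<close>, each of them extended by zero
  to the whole space; \<open>L2_class \<Omega> f\<close> is the class of the restriction of \<open>f\<close> to \<open>\<Omega>\<close> and is
  meaningful only if \<open>square_integrable (lebesgue_on \<Omega>) f\<close>.
\<close>

definition L2_on :: "'a::euclidean_space set \<Rightarrow> 'a L2 set" where
  "L2_on \<Omega> = {h. AE x in lebesgue. x \<notin> \<Omega> \<longrightarrow> rep_L2 h x = 0}"

definition L2_class :: "'a::euclidean_space set \<Rightarrow> ('a \<Rightarrow> real) \<Rightarrow> 'a L2" where
  "L2_class \<Omega> f = abs_L2 (\<lambda>x. if x \<in> \<Omega> then f x else 0)"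


section \<open>Bounded Lipschitz domains and their surface measure\<close>

text \<open>
  Near each boundary point the domain is the strict epigraph, in some direction \<open>\<nu>\<close>, of a
  Lipschitz function of the component orthogonal to \<open>\<nu>\<close>.
\<close>

definition bounded_lipschitz_domain :: "'a::euclidean_space set \<Rightarrow> bool" where
  "bounded_lipschitz_domain \<Omega> \<longleftrightarrow>
     open \<Omega> \<and> connected \<Omega> \<and> \<Omega> \<noteq> {} \<and> bounded \<Omega> \<and>
     (\<forall>p\<in>frontier \<Omega>. \<exists>r>0. \<exists>\<nu> K \<gamma>. norm \<nu> = 1 \<and> K-lipschitz_on UNIV (\<gamma> :: 'a \<Rightarrow> real) \<and>
        \<Omega> \<inter> ball p r = {x \<in> ball p r. \<gamma> (x - (x \<bullet> \<nu>) *\<^sub>R \<nu>) < x \<bullet> \<nu>})"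

text \<open>
  The \<open>s\<close>-dimensional Hausdorff measure, normalised to agree with Lebesgue measure. The case
  distinction on the empty set matters for \<open>s = 0\<close>, where \<open>0 ^ 0 = 1\<close>.
\<close>

definition hausdorff_premeasure :: "nat \<Rightarrow> real \<Rightarrow> 'a::euclidean_space set \<Rightarrow> ennreal" where
  "hausdorff_premeasure s \<eta> S =
     (INF C\<in>{C :: nat \<Rightarrow> 'a set. S \<subseteq> (\<Union>i. C i) \<and> (\<forall>i. bounded (C i) \<and> diameter (C i) \<le> \<eta>)}.
        \<Sum>i. if C i = {} then 0
            else ennreal (unit_ball_vol (real s) * (diameter (C i) / 2) ^ s))"

definition hausdorff_measure :: "nat \<Rightarrow> 'a::euclidean_space measure" where
  "hausdorff_measure s =
     measure_of UNIV (sets borel) (\<lambda>S. SUP \<eta>\<in>{0<..}. hausdorff_premeasure s \<eta> S)"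

definition surface_measure :: "'a::euclidean_space set \<Rightarrow> 'a measure" where
  "surface_measure \<Omega> = restrict_space (hausdorff_measure (DIM('a) - 1)) (frontier \<Omega>)"

text \<open>
  To say of an element of an abstract space \<open>Z\<close> of boundary data that it lies in the space of
  square integrable functions on the boundary, both spaces have to be subspaces of a common vector
  space. Here \<open>j\<close> is the inclusion of \<open>Z\<close> into that space, and \<open>k\<close> is the inclusion of the square
  integrable functions on the boundary, given on representatives.
\<close>

definition boundary_inclusions ::
  "'a::euclidean_space set \<Rightarrow> ('z::real_vector \<Rightarrow> 'w::real_vector) \<Rightarrow> (('a \<Rightarrow> real) \<Rightarrow> 'w) \<Rightarrow> bool"
where
  "boundary_inclusions \<Omega> j k \<longleftrightarrow>
     linear j \<and> inj j \<and>
     (\<forall>f g. square_integrable (surface_measure \<Omega>) f \<longrightarrow>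
            square_integrable (surface_measure \<Omega>) g \<longrightarrow>
        k (\<lambda>x. f x + g x) = k f + k g \<and>
        (\<forall>c. k (\<lambda>x. c * f x) = c *\<^sub>R k f) \<and>
        (k f = k g \<longleftrightarrow> (AE x in surface_measure \<Omega>. f x = g x)))"

definition in_L2_boundary ::
  "'a::euclidean_space set \<Rightarrow> ('z \<Rightarrow> 'w) \<Rightarrow> (('a \<Rightarrow> real) \<Rightarrow> 'w) \<Rightarrow> 'z \<Rightarrow> bool"
where
  "in_L2_boundary \<Omega> j k z \<longleftrightarrow> (\<exists>g. square_integrable (surface_measure \<Omega>) g \<and> j z = k g)"


section \<open>Embeddings and weak convergence\<close>

definition continuous_embedding :: "('a::real_normed_vector \<Rightarrow> 'b::real_normed_vector) \<Rightarrow> bool"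
where
  "continuous_embedding i \<longleftrightarrow> bounded_linear i \<and> inj i"

definition compact_embedding :: "('a::real_normed_vector \<Rightarrow> 'b::real_normed_vector) \<Rightarrow> bool"
where
  "compact_embedding i \<longleftrightarrow>
     continuous_embedding i \<and> (\<forall>S. bounded S \<longrightarrow> compact (closure (i ` S)))"

definition weakly_converges :: "(nat \<Rightarrow> 'a::real_normed_vector) \<Rightarrow> 'a \<Rightarrow> bool" where
  "weakly_converges y y0 \<longleftrightarrow>
     (\<forall>\<phi> :: 'a \<Rightarrow>\<^sub>L real. (\<lambda>k. blinfun_apply \<phi> (y k)) \<longlonglongrightarrow> blinfun_apply \<phi> y0)"


section \<open>Feed-forward neural networks\<close>

text \<open>
  Layers are counted from \<open>0\<close>: \<open>ns ! l\<close> is the width of layer \<open>l\<close>, and \<open>nn_layer \<sigma> ns W1 W b x l i\<close>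
  is component \<open>i\<close> of the output of layer \<open>l\<close> (for \<open>i < ns ! l\<close>). The first layer has the weight
  matrix \<open>W1\<close>, whose columns are indexed by the coordinates of the input; \<open>W l\<close> is the weight matrix
  from layer \<open>l\<close> to layer \<open>l + 1\<close>. Entries outside the range of the widths are never used.
\<close>

primrec nn_layer ::
  "(real \<Rightarrow> real) \<Rightarrow> nat list \<Rightarrow> (nat \<Rightarrow> 'd \<Rightarrow> real) \<Rightarrow> (nat \<Rightarrow> nat \<Rightarrow> nat \<Rightarrow> real) \<Rightarrow>
   (nat \<Rightarrow> nat \<Rightarrow> real) \<Rightarrow> real^'d::finite \<Rightarrow> nat \<Rightarrow> nat \<Rightarrow> real"
where
  "nn_layer \<sigma> ns W1 W b x 0 = (\<lambda>i. (\<Sum>j\<in>UNIV. W1 i j * x $ j) + b 0 i)"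
| "nn_layer \<sigma> ns W1 W b x (Suc l) =
     (\<lambda>i. (\<Sum>j<ns ! l. W l i j * \<sigma> (nn_layer \<sigma> ns W1 W b x l j)) + b (Suc l) i)"

text \<open>
  An architecture vector lists the widths of all layers except the input layer, whose width is the
  dimension of the domain. The output is scalar.
\<close>

definition architecture :: "nat list \<Rightarrow> bool" where
  "architecture ns \<longleftrightarrow> ns \<noteq> [] \<and> (\<forall>n\<in>set ns. 1 \<le> n) \<and> last ns = 1"

definition nn_realizations :: "(real \<Rightarrow> real) \<Rightarrow> nat list \<Rightarrow> (real^'d::finite \<Rightarrow> real) set" where
  "nn_realizations \<sigma> ns =
     {R. \<exists>ms W1 W b. architecture ms \<and> list_all2 (\<le>) ms ns \<and>
           R = (\<lambda>x. nn_layer \<sigma> ms W1 W b x (length ms - 1) 0)}"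

text \<open>
  The networks of a class as elements of a function space \<open>X\<close> that is embedded by \<open>i\<close> into the
  square integrable functions on \<open>\<Omega>\<close>; the second definition says that all networks of the class
  belong to \<open>X\<close>.
\<close>

definition nn_class ::
  "(real^'d::finite) set \<Rightarrow> ('x \<Rightarrow> (real^'d) L2) \<Rightarrow> (real \<Rightarrow> real) \<Rightarrow> nat list \<Rightarrow> 'x set"
where
  "nn_class \<Omega> i \<sigma> ns =
     {x. \<exists>R\<in>nn_realizations \<sigma> ns. square_integrable (lebesgue_on \<Omega>) R \<and> i x = L2_class \<Omega> R}"

definition nn_contained ::
  "(real^'d::finite) set \<Rightarrow> ('x \<Rightarrow> (real^'d) L2) \<Rightarrow> (real \<Rightarrow> real) \<Rightarrow> nat list \<Rightarrow> bool"
where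
  "nn_contained \<Omega> i \<sigma> ns \<longleftrightarrow>
     (\<forall>R\<in>nn_realizations \<sigma> ns. square_integrable (lebesgue_on \<Omega>) R \<and> (\<exists>x. i x = L2_class \<Omega> R))"


section \<open>The compression operator and the functionals\<close>

definition inner_region :: "'a::euclidean_space set \<Rightarrow> real \<Rightarrow> 'a set" where
  "inner_region \<Omega> \<delta> = {z \<in> \<Omega>. \<delta> / 2 < infdist z (frontier \<Omega>)}"

definition compression :: "'a::euclidean_space set \<Rightarrow> real \<Rightarrow> 'a L2 \<Rightarrow> 'a L2" where
  "compression \<Omega> \<delta> v =
     L2_class \<Omega> (\<lambda>x. if x \<in> inner_region \<Omega> \<delta>
       then (\<integral>z\<in>cball x (\<delta> / 2). rep_L2 v z \<partial>lebesgue) / measure lebesgue (cball x (\<delta> / 2))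
       else rep_L2 v x)"

definition compression_misfit ::
  "'a::euclidean_space set \<Rightarrow> real \<Rightarrow> 'a L2 \<Rightarrow> 'a L2 \<Rightarrow> real"
where
  "compression_misfit \<Omega> \<delta> y v = (norm (compression \<Omega> \<delta> v - compression \<Omega> \<delta> y))\<^sup>2"

definition fine_functional ::
  "('u::real_normed_vector \<Rightarrow>\<^sub>L 'h::real_normed_vector) \<Rightarrow> ('u \<Rightarrow>\<^sub>L 'z::real_normed_vector) \<Rightarrow>
   'h \<Rightarrow> real \<Rightarrow> 'u \<Rightarrow> real"
where
  "fine_functional A B f \<tau>\<^sub>1 v =
     (norm (blinfun_apply A v - f))\<^sup>2 + \<tau>\<^sub>1 * (norm (blinfun_apply B v))\<^sup>2"

text \<open>
  The fine-to-coarse scale map. Functions in \<open>L2\<close> act on \<open>Y\<close> through the Gelfand triple,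
  that is, by the inner product with the embedded element.
\<close>

definition scale_map ::
  "('y::real_normed_vector \<Rightarrow> 'h::real_inner) \<Rightarrow> ('u \<Rightarrow> 'y \<Rightarrow>\<^sub>L 'y \<Rightarrow>\<^sub>L real) \<Rightarrow> 'h \<Rightarrow> 'u \<Rightarrow> 'y"
where
  "scale_map i L ft u =
     (THE y. \<forall>v. blinfun_apply (blinfun_apply (L u) y) v = inner ft (i v))"

definition is_approximating_sequence ::
  "('x \<Rightarrow> 'u::real_normed_vector) \<Rightarrow> ('u \<Rightarrow>\<^sub>L 'h::real_normed_vector) \<Rightarrow>
   ('u \<Rightarrow>\<^sub>L 'z::real_normed_vector) \<Rightarrow> 'h \<Rightarrow> 'u \<Rightarrow> (nat \<Rightarrow> 'x) \<Rightarrow> bool"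
where
  "is_approximating_sequence i A B f u xs \<longleftrightarrow>
     (\<lambda>k. norm (i (xs k) - u)) \<longlonglongrightarrow> 0 \<and>
     (\<lambda>k. norm (blinfun_apply A (i (xs k)) - f) + norm (blinfun_apply B (i (xs k)))) \<longlonglongrightarrow> 0"

end

theory Submission
  imports Defs
begin

text \<open>
  Since the classes are nested, the values of a quasi-minimizing sequence converge to the infimum of
  the reduced functional over the union of the classes within the ball. By density of the networks
  in \<open>U\<close>, there are networks in the ball that converge to the exact solution; they form an
  approximating sequence, so their coarse solutions converge weakly in \<open>Y\<close> and, by compactness of
  the embedding, strongly in \<open>L2\<close>. As the compression operator is bounded on \<open>L2\<close>, the functional
  along this sequence tends to the compression misfit of the exact solution, which therefore bounds
  the infimum. The error estimate is then the lower bound of the fine-scale stability.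
\<close>

section \<open>Weak convergence and compact embeddings\<close>

text \<open>Baire category: the closed sets \<open>E n\<close> on which all \<open>T i\<close> are
  bounded by \<open>n\<close> cover a complete space, so one of them contains a ball. Differences of
  points of that ball transfer the bound to a neighbourhood of zero.\<close>

lemma uniform_boundedness:
  fixes T :: "'i \<Rightarrow> 'a::{real_normed_vector,complete_space} \<Rightarrow>\<^sub>L 'b::real_normed_vector"
  assumes "\<And>x. \<exists>K. \<forall>i. norm (T i x) \<le> K"
  shows "\<exists>K. \<forall>i. norm (T i) \<le> K"
proof -
  define E where "E n = {x. \<forall>i. norm (T i x) \<le> real n}" for n
  have closed_E: "closed (E n)" for n
  proof -
    have "E n = (\<Inter>i. {x. norm (T i x) \<le> real n})"
      by (auto simp: E_def)
    moreover have "closed {x. norm (T i x) \<le> real n}" for i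
      by (intro closed_Collect_le continuous_intros)
    ultimately show ?thesis
      by auto
  qed
  have "(\<Union>n. E n) = UNIV"
  proof -
    have "\<exists>n. x \<in> E n" for x
    proof -
      obtain K where "\<forall>i. norm (T i x) \<le> K"
        using assms by blast
      moreover obtain n where "K \<le> real n"
        using real_arch_simple by blast
      ultimately show ?thesis
        unfolding E_def using order_trans by blast
    qed
    then show ?thesis
      by blast
  qed
  have "\<exists>n. interior (E n) \<noteq> {}"
  proof (rule ccontr)
    assume "\<not> (\<exists>n. interior (E n) \<noteq> {})"
    then have "Met_TC.mtopology interior_of \<Union>(range E) = {}"
      by (intro Met_TC.metric_Baire_category_alt)
        (use closed_E complete_UNIV in \<open>auto\<close>)
    then show False
      using \<open>(\<Union>n. E n) = UNIV\<close> by simp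
  qed
  then obtain n a e where e: "0 < e" "ball a e \<subseteq> E n"
    by (auto simp: mem_interior)
  have "norm (T i x) \<le> 4 * real n / e * norm x" for i x
  proof (cases "x = 0")
    case False
    \<comment> \<open>Rescaling to length \<open>e / 2\<close> keeps \<open>a + z\<close> in the
      ball. Writing \<open>T i z\<close> as a difference of two values of size at most
      \<open>n\<close> costs a factor 2 and undoing the scaling another, hence
      \<open>4 * real n / e\<close>.\<close>
    define z where "z = (e / (2 * norm x)) *\<^sub>R x"
    have "norm z < e"
      using False e(1) by (simp add: z_def)
    then have "a + z \<in> E n" "a \<in> E n"
      using e by (auto simp: subset_iff dist_norm)
    then have "norm (T i (a + z)) \<le> real n" "norm (T i a) \<le> real n"
      by (auto simp: E_def)
    moreover have "T i z = T i (a + z) - T i a"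
      by (simp add: blinfun.add_right)
    ultimately have "norm (T i z) \<le> 2 * real n"
      using norm_triangle_ineq4[of "T i (a + z)" "T i a"] by simp
    moreover have "norm (T i z) = e / (2 * norm x) * norm (T i x)"
      using e(1) by (simp add: z_def blinfun.scaleR_right)
    ultimately show ?thesis
      using False e(1) by (simp add: field_simps)
  qed simp
  then have "norm (T i) \<le> 4 * real n / e" for i
    using e(1) by (intro norm_blinfun_bound) auto
  then show ?thesis
    by blast
qed

lemma weakly_converges_inner:
  assumes "weakly_converges y y0"
  shows "(\<lambda>k. inner w (y k)) \<longlonglongrightarrow> inner w y0"
  using assms[unfolded weakly_converges_def, rule_format, of "blinfun_inner_right w"] by simp

text \<open>The functionals \<open>inner (y k)\<close> converge at every point and so are pointwise
  bounded; uniform boundedness applies, and evaluating each functional at \<open>y k\<close> itself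
  recovers the norm of \<open>y k\<close>.\<close>

lemma weakly_converges_imp_bounded:
  fixes y :: "nat \<Rightarrow> 'a::{real_inner,complete_space}"
  assumes "weakly_converges y y0"
  shows "bounded (range y)"
proof -
  have "\<exists>K. \<forall>k. norm (blinfun_inner_right (y k) w) \<le> K" for w
  proof -
    have "Bseq (\<lambda>k. inner w (y k))"
      using weakly_converges_inner[OF assms] by (intro convergent_imp_Bseq convergentI)
    then show ?thesis
      by (auto simp: Bseq_def inner_commute)
  qed
  then obtain K where K: "norm (blinfun_inner_right (y k)) \<le> K" for k
    using uniform_boundedness[of "\<lambda>k. blinfun_inner_right (y k)"] by blast
  have "norm (y k) \<le> K" for k
  proof (cases "y k = 0")
    case True
    then show ?thesis
      using order_trans[OF norm_ge_zero K[of k]] by simp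
  next
    case False
    have "norm (y k) * norm (y k) = norm (blinfun_inner_right (y k) (y k))"
      by (simp flip: power2_norm_eq_inner add: power2_eq_square)
    also have "\<dots> \<le> K * norm (y k)"
      using norm_blinfun[of "blinfun_inner_right (y k)" "y k"] K[of k]
      by (meson mult_right_mono norm_ge_zero order_trans)
    finally show ?thesis
      using False by simp
  qed
  then show ?thesis
    by (auto simp: bounded_iff)
qed

text \<open>The images lie in a compact set, so a subsequence staying away from \<open>i y0\<close>
  would have a convergent subsequence of its own. Its limit must agree with the weak limit
  \<open>i y0\<close>, a contradiction.\<close>

lemma compact_embedding_weakly_converges:
  fixes i :: "'a::{real_inner,complete_space} \<Rightarrow> 'b::real_inner"
  assumes i: "compact_embedding i" and y: "weakly_converges y y0"
  shows "(\<lambda>k. i (y k)) \<longlonglongrightarrow> i y0"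
proof (rule ccontr)
  have lin: "bounded_linear i"
    using i by (simp add: compact_embedding_def continuous_embedding_def)
  have comp: "compact (closure (i ` range y))"
    using i weakly_converges_imp_bounded[OF y] by (simp add: compact_embedding_def)
  \<comment> \<open>Testing against \<open>h\<close> after \<open>i\<close> is a bounded functional
    on the source space, so weak convergence passes to the images.\<close>
  have weak: "(\<lambda>k. inner h (i (y k))) \<longlonglongrightarrow> inner h (i y0)" for h
  proof -
    have lin_h: "bounded_linear (\<lambda>z. inner h (i z))"
      using bounded_linear_compose[OF bounded_linear_inner_right lin] .
    from y[unfolded weakly_converges_def, rule_format, of "Blinfun (\<lambda>z. inner h (i z))"]
    show ?thesis
      by (simp add: bounded_linear_Blinfun_apply[OF lin_h])
  qed
  assume "\<not> ?thesis"
  then obtain e where "0 < e" and not_ev: "\<not> (\<forall>\<^sub>F k in sequentially. dist (i (y k)) (i y0) < e)"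
    by (auto simp: tendsto_iff)
  \<comment> \<open>On the naturals \<open>sequentially\<close> is the cofinite filter, so failure
    of convergence leaves infinitely many bad indices, which are enumerated by
    \<open>\<rho>\<close>.\<close>
  have "infinite {k. \<not> dist (i (y k)) (i y0) < e}"
    using not_ev by (simp add: eventually_cofinite flip: cofinite_eq_sequentially)
  then obtain \<rho> :: "nat \<Rightarrow> nat" where \<rho>: "strict_mono \<rho>" "\<And>n. \<not> dist (i (y (\<rho> n))) (i y0) < e"
    using infinite_enumerate[of "{k. \<not> dist (i (y k)) (i y0) < e}"] by auto
  have "\<forall>n. i (y (\<rho> n)) \<in> closure (i ` range y)"
    by (auto intro!: closure_subset[THEN subsetD])
  then obtain h \<rho>' where \<rho>': "strict_mono \<rho>'" "((\<lambda>n. i (y (\<rho> n))) \<circ> \<rho>') \<longlonglongrightarrow> h"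
    using seq_compactE[OF comp[unfolded compact_eq_seq_compact_metric]] by metis
  \<comment> \<open>Testing both limits with their own difference forces this difference to have
    norm zero.\<close>
  define w where "w = h - i y0"
  have "(\<lambda>n. inner w (i (y (\<rho> (\<rho>' n))))) \<longlonglongrightarrow> inner w h"
    using \<rho>'(2) by (auto intro!: tendsto_intros simp: o_def)
  moreover have "(\<lambda>n. inner w (i (y (\<rho> (\<rho>' n))))) \<longlonglongrightarrow> inner w (i y0)"
    using LIMSEQ_subseq_LIMSEQ[OF weak strict_mono_o[OF \<rho>(1) \<rho>'(1)], of w] by (simp add: o_def)
  ultimately have "inner w h = inner w (i y0)"
    by (rule LIMSEQ_unique)
  then have "inner w w = 0"
    by (simp add: w_def inner_diff_right)
  then have "h = i y0"
    by (simp add: w_def)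
  then have "\<forall>\<^sub>F n in sequentially. dist (i (y (\<rho> (\<rho>' n)))) (i y0) < e"
    using \<rho>'(2) \<open>0 < e\<close> by (auto simp: tendsto_iff o_def)
  then show False
    using \<rho>(2) by simp
qed

section \<open>Quasi-minimizing sequences over nested sets\<close>

text \<open>A point that nearly attains the infimum over the union lies in \<open>K n\<close> for
  all large \<open>n\<close>, so it bounds \<open>J (u n)\<close> from above up to
  \<open>\<gamma> n\<close>. The lower bound is immediate, as \<open>u n\<close> belongs to the
  union.\<close>

lemma quasi_minimizers_tendsto_infimum:
  fixes J :: "'a \<Rightarrow> real" and K :: "nat \<Rightarrow> 'a set"
  assumes mono: "\<And>n. K n \<subseteq> K (Suc n)"
    and nonneg: "\<And>v. 0 \<le> J v"
    and mem: "\<And>n. n \<ge> N \<Longrightarrow> u n \<in> K n"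
    and quasi: "\<And>n. n \<ge> N \<Longrightarrow> J (u n) \<le> (INF v\<in>K n. J v) + \<gamma> n"
    and \<gamma>: "\<gamma> \<longlonglongrightarrow> 0"
  shows "(\<lambda>n. J (u n)) \<longlonglongrightarrow> (INF v\<in>(\<Union>n. K n). J v)"
proof (rule LIMSEQ_I)
  define m where "m = (INF v\<in>(\<Union>n. K n). J v)"
  have bdd: "bdd_below (J ` A)" for A
    using nonneg by (auto intro: bdd_belowI[of _ 0])
  fix e :: real
  assume "0 < e"
  \<comment> \<open>The tolerance is split evenly: \<open>e / 2\<close> for the choice of
    \<open>v\<close> and \<open>e / 2\<close> for the slack \<open>\<gamma> n\<close>.\<close>
  have "(\<Union>n. K n) \<noteq> {}"
    using mem[of N] by auto
  then obtain v where v: "v \<in> (\<Union>n. K n)" "J v < m + e / 2"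
    using cINF_less_iff[of "\<Union>n. K n" J "m + e / 2"] bdd \<open>0 < e\<close> m_def by auto
  then obtain n0 where n0: "v \<in> K n0"
    by auto
  obtain n1 where n1: "\<And>n. n \<ge> n1 \<Longrightarrow> norm (\<gamma> n - 0) < e / 2"
    using LIMSEQ_D[OF \<gamma>, of "e / 2"] \<open>0 < e\<close> by auto
  have "norm (J (u n) - m) < e" if "n \<ge> max N (max n0 n1)" for n
  proof -
    have "v \<in> K n"
      using n0 that lift_Suc_mono_le[of K n0 n] mono by auto
    then have "(INF v\<in>K n. J v) \<le> J v"
      by (intro cINF_lower bdd)
    moreover have "m \<le> J (u n)"
      unfolding m_def using mem[of n] that by (intro cINF_lower bdd) auto
    ultimately show ?thesis
      using quasi[of n] n1[of n] v(2) that by (simp add: abs_less_iff)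
  qed
  then show "\<exists>no. \<forall>n\<ge>no. norm (J (u n) - (INF v\<in>(\<Union>n. K n). J v)) < e"
    unfolding m_def by blast
qed

section \<open>Representatives of square integrable classes\<close>

lemma square_integrable_rep_L2: "square_integrable lebesgue (rep_L2 v)"
  using Quotient3_rep_reflp[OF Quotient3_L2] by blast

lemma borel_measurable_rep_L2: "rep_L2 v \<in> borel_measurable lebesgue"
  using square_integrable_rep_L2[of v] by (simp add: square_integrable_def)

lemma abs_rep_L2: "abs_L2 (rep_L2 v) = v"
  by (rule Quotient3_abs_rep[OF Quotient3_L2])

lemma rep_abs_L2:
  assumes "square_integrable lebesgue f"
  shows "AE x in lebesgue. rep_L2 (abs_L2 f) x = f x"
  using Quotient3_rep_abs[OF Quotient3_L2, of f] assms by simp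

lemma abs_L2_cong:
  assumes "square_integrable lebesgue f" "square_integrable lebesgue g"
    and "AE x in lebesgue. f x = g x"
  shows "abs_L2 f = abs_L2 g"
  using Quotient3_rel[OF Quotient3_L2, of f g] assms by simp

lemma inner_abs_L2:
  assumes "square_integrable lebesgue f" "square_integrable lebesgue g"
  shows "inner (abs_L2 f) (abs_L2 g) = (\<integral>x. f x * g x \<partial>lebesgue)"
  using assms by (simp add: inner_L2.abs_eq)

text \<open>\<open>rep_L2\<close> selects an arbitrary representative, so it respects addition only
  up to a null set.\<close>

lemma rep_L2_plus: "AE x in lebesgue. rep_L2 (v + w) x = rep_L2 v x + rep_L2 w x"
proof -
  have "v + w = abs_L2 (\<lambda>x. rep_L2 v x + rep_L2 w x)"
    by (subst plus_L2.abs_eq[symmetric]) (simp_all add: square_integrable_rep_L2 abs_rep_L2)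
  then show ?thesis
    using rep_abs_L2[OF square_integrable_add,
        OF square_integrable_rep_L2[of v] square_integrable_rep_L2[of w]]
    by simp
qed

lemma rep_L2_scaleR: "AE x in lebesgue. rep_L2 (c *\<^sub>R v) x = c * rep_L2 v x"
proof -
  have "c *\<^sub>R v = abs_L2 (\<lambda>x. c * rep_L2 v x)"
    by (subst scaleR_L2.abs_eq[symmetric]) (simp_all add: square_integrable_rep_L2 abs_rep_L2)
  then show ?thesis
    using rep_abs_L2[OF square_integrable_scale[OF square_integrable_rep_L2[of v], of c]] by simp
qed

lemma square_integrable_indicator:
  assumes "D \<in> lmeasurable"
  shows "square_integrable lebesgue (indicator D :: 'a::euclidean_space \<Rightarrow> real)"
proof -
  have "(\<lambda>x. (indicator D x)\<^sup>2) = (indicator D :: 'a \<Rightarrow> real)"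
    by (auto simp: indicator_def)
  then show ?thesis
    using assms by (auto simp: square_integrable_def fmeasurable_def)
qed

lemma set_integrable_rep_L2:
  assumes "D \<in> lmeasurable"
  shows "set_integrable lebesgue D (rep_L2 v)"
  using square_integrable_mult[OF square_integrable_indicator[OF assms] square_integrable_rep_L2]
  by (simp add: set_integrable_def)

text \<open>Cauchy-Schwarz against the class of the indicator of \<open>D\<close>, whose squared
  norm is the measure of \<open>D\<close>.\<close>

lemma abs_set_integral_rep_L2_le:
  assumes "D \<in> lmeasurable"
  shows "\<bar>\<integral>x\<in>D. rep_L2 v x \<partial>lebesgue\<bar> \<le> sqrt (measure lebesgue D) * norm v"
proof -
  define \<phi> where "\<phi> = abs_L2 (indicator D :: 'a \<Rightarrow> real)"
  have "(\<integral>x\<in>D. rep_L2 v x \<partial>lebesgue) = inner \<phi> v"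
    using inner_abs_L2[OF square_integrable_indicator[OF assms] square_integrable_rep_L2]
    by (simp add: set_lebesgue_integral_def \<phi>_def abs_rep_L2)
  moreover have "inner \<phi> \<phi> = measure lebesgue D"
  proof -
    have "(\<lambda>x. indicator D x * indicator D x) = (indicator D :: 'a \<Rightarrow> real)"
      by (auto simp: indicator_def)
    then show ?thesis
      using inner_abs_L2[OF square_integrable_indicator[OF assms] square_integrable_indicator[OF assms]]
        assms
      by (simp add: \<phi>_def fmeasurableD2)
  qed
  ultimately show ?thesis
    using Cauchy_Schwarz_ineq2[of \<phi> v] by (simp add: norm_eq_sqrt_inner)
qed

section \<open>Ball averages and the compression operator\<close>

text \<open>Dominated convergence along a sequence of centres. The continuity serves to make the
  averages in the compression operator measurable.\<close>

lemma isCont_set_integral_cball: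
  fixes g :: "'a::euclidean_space \<Rightarrow> real"
  assumes int: "\<And>K. set_integrable lebesgue (cball 0 K) g"
  shows "isCont (\<lambda>x. \<integral>z\<in>cball x \<rho>. g z \<partial>lebesgue) x"
proof (rule continuous_within_sequentiallyI)
  fix u :: "nat \<Rightarrow> 'a"
  assume u: "u \<longlonglongrightarrow> x"
  then obtain K where K: "\<And>n. norm (u n) \<le> K"
    using convergent_imp_Bseq[OF convergentI[OF u]] by (auto simp: Bseq_def)
  have meas: "(\<lambda>z. indicator (cball y \<rho>) z *\<^sub>R g z) \<in> borel_measurable lebesgue" for y
  proof -
    have "cball y \<rho> \<subseteq> cball 0 (norm y + \<rho>)"
    proof
      fix z
      assume "z \<in> cball y \<rho>"
      then show "z \<in> cball 0 (norm y + \<rho>)"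
        using norm_triangle_sub[of z y] by (simp add: dist_norm norm_minus_commute)
    qed
    then have "set_integrable lebesgue (cball y \<rho>) g"
      by (intro set_integrable_subset[OF int]) auto
    then show ?thesis
      by (auto simp: set_integrable_def)
  qed
  show "(\<lambda>n. \<integral>z\<in>cball (u n) \<rho>. g z \<partial>lebesgue) \<longlonglongrightarrow> (\<integral>z\<in>cball x \<rho>. g z \<partial>lebesgue)"
    unfolding set_lebesgue_integral_def
  proof (rule integral_dominated_convergence)
    \<comment> \<open>A convergent sequence of centres is bounded by some \<open>K\<close>, so one
      centred ball of radius \<open>K + \<rho>\<close> contains all the moving balls.\<close>
    show "integrable lebesgue (\<lambda>z. norm (indicator (cball 0 (K + \<rho>)) z *\<^sub>R g z))"
      using int[of "K + \<rho>"] by (intro integrable_norm) (simp add: set_integrable_def)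
    show "AE z in lebesgue. norm (indicator (cball (u n) \<rho>) z *\<^sub>R g z)
        \<le> norm (indicator (cball 0 (K + \<rho>)) z *\<^sub>R g z)" for n
    proof (rule AE_I2)
      fix z
      have "norm z \<le> K + \<rho>" if "dist (u n) z \<le> \<rho>"
        using K[of n] that norm_triangle_sub[of z "u n"] by (simp add: dist_norm norm_minus_commute)
      then show "norm (indicator (cball (u n) \<rho>) z *\<^sub>R g z)
          \<le> norm (indicator (cball 0 (K + \<rho>)) z *\<^sub>R g z)"
        by (auto simp: indicator_def)
    qed
    \<comment> \<open>Off the limiting sphere, membership of \<open>z\<close> in the moving ball is
      eventually constant; on it the indicators need not converge, but the sphere is a null
      set.\<close>
    have "AE z in lebesgue. z \<notin> sphere x \<rho>"
      using negligible_sphere[of x \<rho>] by (intro AE_not_in) (simp add: negligible_iff_null_sets)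
    then show "AE z in lebesgue. (\<lambda>n. indicator (cball (u n) \<rho>) z *\<^sub>R g z)
        \<longlonglongrightarrow> indicator (cball x \<rho>) z *\<^sub>R g z"
    proof eventually_elim
      case (elim z)
      have lim: "(\<lambda>n. dist (u n) z) \<longlonglongrightarrow> dist x z"
        using u by (intro tendsto_intros)
      have "\<forall>\<^sub>F n in sequentially. (indicator (cball (u n) \<rho>) z :: real) = indicator (cball x \<rho>) z"
      proof (cases "dist x z < \<rho>")
        case True
        from order_tendstoD(2)[OF lim this] show ?thesis
          by eventually_elim (use True in \<open>auto simp: indicator_def\<close>)
      next
        case False
        then have gt: "\<rho> < dist x z"
          using elim by auto
        from order_tendstoD(1)[OF lim this] show ?thesis
          by eventually_elim (use gt in \<open>auto simp: indicator_def\<close>)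
      qed
      then show ?case
        by (intro tendsto_eventually) (auto elim: eventually_mono)
    qed
  qed (rule meas)+
qed

lemma measure_lebesgue_cball:
  fixes x :: "'a::euclidean_space"
  assumes "0 \<le> \<rho>"
  shows "measure lebesgue (cball x \<rho>) = unit_ball_vol (DIM('a)) * \<rho> ^ DIM('a)"
  using content_cball[OF assms, of x] by (simp add: measure_completion)

lemma open_inner_region:
  assumes "open \<Omega>"
  shows "open (inner_region \<Omega> \<delta>)"
proof -
  have "inner_region \<Omega> \<delta> = \<Omega> \<inter> {z. \<delta> / 2 < infdist z (frontier \<Omega>)}"
    by (auto simp: inner_region_def)
  then show ?thesis
    using assms by (auto intro!: open_Int open_Collect_less continuous_intros)
qed

text \<open>By Cauchy-Schwarz the averages are bounded pointwise by a multiple of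
  \<open>norm v\<close>, which is square integrable over the bounded set \<Omega>; in the boundary
  layer the operator is the identity.\<close>

lemma bounded_linear_compression:
  fixes \<Omega> :: "'a::euclidean_space set"
  assumes "open \<Omega>" "bounded \<Omega>" "0 < \<delta>"
  shows "bounded_linear (compression \<Omega> \<delta>)"
proof -
  define m where "m = unit_ball_vol (real DIM('a)) * (\<delta> / 2) ^ DIM('a)"
  have m: "measure lebesgue (cball x (\<delta> / 2)) = m" for x :: 'a
    unfolding m_def using assms(3) by (intro measure_lebesgue_cball) simp
  have "0 < m"
    unfolding m_def using assms(3) by simp
  define avg where "avg v x = (\<integral>z\<in>cball x (\<delta> / 2). rep_L2 v z \<partial>lebesgue) / m"
    for v :: "'a L2" and x
  define q where "q v x = (if x \<in> \<Omega> then if x \<in> inner_region \<Omega> \<delta> then avg v x else rep_L2 v x else 0)"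
    for v :: "'a L2" and x
  have compression_eq: "compression \<Omega> \<delta> v = abs_L2 (q v)" for v
    unfolding compression_def L2_class_def q_def avg_def m ..
  \<comment> \<open>The factor \<open>sqrt m\<close> is the Cauchy-Schwarz constant of a ball of
    measure \<open>m\<close>; the division by \<open>m\<close> comes from averaging.\<close>
  define c where "c = sqrt m / m"
  have abs_avg: "\<bar>avg v x\<bar> \<le> c * norm v" for v x
    using abs_set_integral_rep_L2_le[of "cball x (\<delta> / 2)" v] \<open>0 < m\<close>
    unfolding m by (simp add: avg_def c_def divide_right_mono)
  have \<Omega>: "\<Omega> \<in> lmeasurable"
    using assms by (intro lmeasurable_open) auto
  have meas: "q v \<in> borel_measurable lebesgue" for v
  proof -
    have "isCont (\<lambda>x. \<integral>z\<in>cball x (\<delta> / 2). rep_L2 v z \<partial>lebesgue) x" for x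
      by (intro isCont_set_integral_cball set_integrable_rep_L2) simp
    then have "continuous_on UNIV (avg v)"
      unfolding avg_def using \<open>0 < m\<close> by (intro continuous_at_imp_continuous_on ballI) auto
    then have "avg v \<in> borel_measurable lebesgue"
      by (intro measurable_completion) (simp add: borel_measurable_continuous_onI)
    moreover note borel_measurable_rep_L2[of v]
    moreover have "{x \<in> space lebesgue. x \<in> \<Omega>} \<in> sets lebesgue"
      "{x \<in> space lebesgue. x \<in> inner_region \<Omega> \<delta>} \<in> sets lebesgue"
      using assms(1) open_inner_region[OF assms(1), of \<delta>] by auto
    ultimately show ?thesis
      unfolding q_def[abs_def] by (intro measurable_If) auto
  qed
  \<comment> \<open>Whichever branch of \<open>q\<close> is active, its square is dominated by one
    of the two nonnegative summands.\<close>
  have q_le: "(q v x)\<^sup>2 \<le> (c * norm v)\<^sup>2 * indicator \<Omega> x + (rep_L2 v x)\<^sup>2" for v x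
  proof -
    have "(avg v x)\<^sup>2 \<le> (c * norm v)\<^sup>2"
      using order_trans[OF abs_avg abs_ge_self] by (rule abs_le_square_iff[THEN iffD1])
    then show ?thesis
      by (auto simp: q_def intro: add_increasing add_increasing2)
  qed
  have int_bound: "integrable lebesgue (\<lambda>x. (c * norm v)\<^sup>2 * indicator \<Omega> x + (rep_L2 v x)\<^sup>2)" for v
    using \<Omega> square_integrable_rep_L2[of v]
    by (intro Bochner_Integration.integrable_add) (auto simp: square_integrable_def fmeasurable_def)
  have sq: "square_integrable lebesgue (q v)" for v
    unfolding square_integrable_def
  proof
    show "integrable lebesgue (\<lambda>x. (q v x)\<^sup>2)"
      by (rule Bochner_Integration.integrable_bound[OF int_bound])
        (use meas q_le in \<open>auto intro!: AE_I2\<close>)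
  qed (rule meas)
  \<comment> \<open>An integral ignores null sets, so almost everywhere identities between
    representatives become identities of averages at every point \<open>x\<close>.\<close>
  have avg_cong: "avg v x = (\<integral>z\<in>cball x (\<delta> / 2). g z \<partial>lebesgue) / m"
    if "AE z in lebesgue. rep_L2 v z = g z" "g \<in> borel_measurable lebesgue" for v g x
    unfolding avg_def set_lebesgue_integral_def using that
    by (intro arg_cong2[where f = "(/)"] integral_cong_AE refl borel_measurable_scaleR
        borel_measurable_indicator borel_measurable_rep_L2 fmeasurableD[OF lmeasurable_cball]) auto
  show ?thesis
  proof (rule bounded_linear_intro)
    fix v w :: "'a L2"
    have avg_add: "avg (v + w) x = avg v x + avg w x" for x
    proof -
      have "avg (v + w) x = (\<integral>z\<in>cball x (\<delta> / 2). rep_L2 v z + rep_L2 w z \<partial>lebesgue) / m"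
        by (intro avg_cong rep_L2_plus borel_measurable_add borel_measurable_rep_L2)
      also have "\<dots> = avg v x + avg w x"
        unfolding avg_def add_divide_distrib[symmetric]
        by (subst set_integral_add) (auto intro: set_integrable_rep_L2)
      finally show ?thesis .
    qed
    have "AE x in lebesgue. q (v + w) x = q v x + q w x"
      using rep_L2_plus[of v w] by eventually_elim (simp add: q_def avg_add)
    then have "abs_L2 (q (v + w)) = abs_L2 (\<lambda>x. q v x + q w x)"
      by (intro abs_L2_cong sq square_integrable_add)
    then show "compression \<Omega> \<delta> (v + w) = compression \<Omega> \<delta> v + compression \<Omega> \<delta> w"
      unfolding compression_eq by (simp add: plus_L2.abs_eq sq)
  next
    fix a and v :: "'a L2"
    have avg_scale: "avg (a *\<^sub>R v) x = a * avg v x" for x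
    proof -
      have "avg (a *\<^sub>R v) x = (\<integral>z\<in>cball x (\<delta> / 2). a * rep_L2 v z \<partial>lebesgue) / m"
        by (intro avg_cong rep_L2_scaleR borel_measurable_times borel_measurable_const
            borel_measurable_rep_L2)
      then show ?thesis
        by (simp add: avg_def)
    qed
    have "AE x in lebesgue. q (a *\<^sub>R v) x = a * q v x"
      using rep_L2_scaleR[of a v] by eventually_elim (simp add: q_def avg_scale)
    then have "abs_L2 (q (a *\<^sub>R v)) = abs_L2 (\<lambda>x. a * q v x)"
      by (intro abs_L2_cong sq square_integrable_scale)
    then show "compression \<Omega> \<delta> (a *\<^sub>R v) = a *\<^sub>R compression \<Omega> \<delta> v"
      unfolding compression_eq by (simp add: scaleR_L2.abs_eq sq)
  next
    fix v :: "'a L2"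
    have "(norm (compression \<Omega> \<delta> v))\<^sup>2 = (\<integral>x. (q v x)\<^sup>2 \<partial>lebesgue)"
      unfolding compression_eq power2_norm_eq_inner
      by (simp add: inner_abs_L2 sq power2_eq_square)
    also have "\<dots> \<le> (\<integral>x. (c * norm v)\<^sup>2 * indicator \<Omega> x + (rep_L2 v x)\<^sup>2 \<partial>lebesgue)"
      using sq int_bound q_le by (intro integral_mono) (auto simp: square_integrable_def)
    also have "\<dots> = (c * norm v)\<^sup>2 * measure lebesgue \<Omega> + (\<integral>x. rep_L2 v x * rep_L2 v x \<partial>lebesgue)"
      using \<Omega> square_integrable_rep_L2[of v]
      by (subst Bochner_Integration.integral_add)
        (auto simp: square_integrable_def fmeasurable_def power2_eq_square)
    also have "(\<integral>x. rep_L2 v x * rep_L2 v x \<partial>lebesgue) = (norm v)\<^sup>2"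
      using inner_abs_L2[OF square_integrable_rep_L2 square_integrable_rep_L2, of v v]
      by (simp add: abs_rep_L2 power2_norm_eq_inner)
    \<comment> \<open>Under the root, the averages contribute
      \<open>c\<^sup>2 * measure lebesgue \<Omega>\<close> and the uncompressed values contribute
      1.\<close>
    finally have "(norm (compression \<Omega> \<delta> v))\<^sup>2 \<le> (norm v * sqrt (c\<^sup>2 * measure lebesgue \<Omega> + 1))\<^sup>2"
      by (simp add: power_mult_distrib algebra_simps)
    then show "norm (compression \<Omega> \<delta> v) \<le> norm v * sqrt (c\<^sup>2 * measure lebesgue \<Omega> + 1)"
      by (rule power2_le_imp_le) simp
  qed
qed

section \<open>Convergence of the quasi-minimizers\<close>

theorem theorem3p2:
  fixes \<Omega> :: "(real^'d) set"
    and iUV :: "'u::{real_inner,complete_space} \<Rightarrow> 'v::banach"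
    and iVH :: "'v \<Rightarrow> (real^'d) L2"
    and iXU :: "'x::real_normed_vector \<Rightarrow> 'u"
    and iYH :: "'y::{real_inner,complete_space} \<Rightarrow> (real^'d) L2"
    and jZ :: "'z::banach \<Rightarrow> 'w::real_vector"
    and kZ :: "(real^'d \<Rightarrow> real) \<Rightarrow> 'w"
    and A :: "real \<Rightarrow> 'u \<Rightarrow>\<^sub>L (real^'d) L2"
    and B :: "'u \<Rightarrow>\<^sub>L 'z"
    and f :: "real \<Rightarrow> (real^'d) L2"
    and L :: "'u \<Rightarrow> 'y \<Rightarrow>\<^sub>L 'y \<Rightarrow>\<^sub>L real"
    and ft :: "(real^'d) L2"
    and \<sigma> :: "real \<Rightarrow> real"
    and arch :: "nat \<Rightarrow> nat list"
    and \<epsilon> \<tau>\<^sub>1 \<tau>\<^sub>2 \<delta> Cs Cb r c\<^sub>1 c\<^sub>2 :: real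
    and ue :: 'u
    and nstar :: nat
    and \<gamma> :: "nat \<Rightarrow> real"
    and uth :: "nat \<Rightarrow> 'u"
  defines "iUH \<equiv> iVH \<circ> iUV"
    and "S \<equiv> scale_map iYH L ft"
    and "NN \<equiv> \<lambda>n. nn_class \<Omega> (iVH \<circ> iUV \<circ> iXU) \<sigma> (arch n)"
    and "Jhat \<equiv> \<lambda>v. fine_functional (A \<epsilon>) B (f \<epsilon>) \<tau>\<^sub>1 v
                  + \<tau>\<^sub>2 * compression_misfit \<Omega> \<delta> (iYH (scale_map iYH L ft v)) ((iVH \<circ> iUV) v)"
  assumes parameters: "\<epsilon> > 0" "\<tau>\<^sub>1 > 0" "\<tau>\<^sub>2 \<ge> 0" "\<delta> > 0"
    and domain: "bounded_lipschitz_domain \<Omega>"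
    \<comment> \<open>function spaces\<close>
    and UVH: "continuous_embedding iUV" "continuous_embedding iVH" "range iVH \<subseteq> L2_on \<Omega>"
    and XU: "continuous_embedding iXU" "closure (range iXU) = UNIV"
    and YH: "compact_embedding iYH" "closure (range iYH) = L2_on \<Omega>"
    and U0Y: "\<forall>u. blinfun_apply B u = 0 \<longrightarrow> iUH u \<in> range iYH"
    and Z: "boundary_inclusions \<Omega> jZ kZ"
    \<comment> \<open>fine-scale and coarse-scale data\<close>
    and AH: "range (blinfun_apply (A \<epsilon>)) \<subseteq> L2_on \<Omega>"
    and fH: "f \<epsilon> \<in> L2_on \<Omega>"
    and ftH: "ft \<in> L2_on \<Omega>"
    and solution: "blinfun_apply (A \<epsilon>) ue = f \<epsilon>" "blinfun_apply B ue = 0"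
    and unique: "\<forall>u. blinfun_apply (A \<epsilon>) u = f \<epsilon> \<and> blinfun_apply B u = 0 \<longrightarrow> u = ue"
    and approximable: "\<exists>xs. is_approximating_sequence iXU (A \<epsilon>) B (f \<epsilon>) ue xs"
    \<comment> \<open>(i)\<close>
    and fine_stability: "Cs > 0" "Cb > 0"
      "\<forall>u. Cs * (norm (iUV u))\<^sup>2 \<le> (norm (blinfun_apply (A \<epsilon>) u))\<^sup>2 + (norm (blinfun_apply B u))\<^sup>2
         \<and> (norm (blinfun_apply (A \<epsilon>) u))\<^sup>2 + (norm (blinfun_apply B u))\<^sup>2 \<le> Cb * (norm u)\<^sup>2"
    \<comment> \<open>(ii)\<close>
    and coarse_stability: "r > 0" "c\<^sub>1 > 0" "c\<^sub>2 > 0"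
      "\<forall>u\<in>cball ue r. \<forall>v w. blinfun_apply (blinfun_apply (L u) v) w \<le> c\<^sub>1 * norm v * norm w"
      "\<forall>u\<in>cball ue r. \<forall>v. blinfun_apply (blinfun_apply (L u) v) v \<ge> c\<^sub>2 * (norm v)\<^sup>2"
    \<comment> \<open>(iii)\<close>
    and architectures: "\<forall>n. architecture (arch n)" "\<forall>n. list_all2 (\<le>) (arch n) (arch (Suc n))"
    and networks: "\<forall>n. nn_contained \<Omega> (iVH \<circ> iUV \<circ> iXU) \<sigma> (arch n)"
      "\<forall>n. NN n \<subseteq> NN (Suc n)"
      "closure (\<Union>n. NN n) = UNIV"
      "\<forall>n. \<forall>x\<in>NN n. blinfun_apply (A \<epsilon>) (iXU x) \<in> L2_on \<Omega>
                   \<and> in_L2_boundary \<Omega> jZ kZ (blinfun_apply B (iXU x))"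
    \<comment> \<open>(iv)\<close>
    and continuity: "\<forall>xs. is_approximating_sequence iXU (A \<epsilon>) B (f \<epsilon>) ue xs
         \<and> (\<forall>k. iXU (xs k) \<in> cball ue r)
         \<longrightarrow> weakly_converges (\<lambda>k. S (iXU (xs k))) (S ue)"
    \<comment> \<open>quasi-minimizing sequence\<close>
    and nonempty: "\<forall>n\<ge>nstar. cball ue r \<inter> iXU ` NN n \<noteq> {}"
    and gamma: "\<forall>n\<ge>nstar. \<gamma> n > 0" "\<forall>n\<ge>nstar. \<gamma> (Suc n) \<le> \<gamma> n" "\<gamma> \<longlonglongrightarrow> 0"
    and quasi_min: "\<forall>n\<ge>nstar. uth n \<in> cball ue r \<inter> iXU ` NN n"
      "\<forall>n\<ge>nstar. Jhat (uth n) \<le> (INF v\<in>cball ue r \<inter> iXU ` NN n. Jhat v) + \<gamma> n"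
  shows "(convergent (\<lambda>n. Jhat (uth n))
          \<and> lim (\<lambda>n. Jhat (uth n)) \<le> \<tau>\<^sub>2 * compression_misfit \<Omega> \<delta> (iYH (S ue)) (iUH ue))
       \<and> (\<tau>\<^sub>1 \<ge> 1 \<longrightarrow>
            limsup (\<lambda>n. ereal (norm (iUV (uth n - ue))))
              \<le> ereal (1 / sqrt Cs * sqrt (\<tau>\<^sub>2 * compression_misfit \<Omega> \<delta> (iYH (S ue)) (iUH ue))))"
proof -
  define Q where "Q = compression \<Omega> \<delta>"
  define m where "m = (INF v\<in>(\<Union>n. cball ue r \<inter> iXU ` NN n). Jhat v)"
  define R where "R = \<tau>\<^sub>2 * compression_misfit \<Omega> \<delta> (iYH (S ue)) (iUH ue)"
  have Q: "bounded_linear Q"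
    unfolding Q_def using domain parameters(4)
    by (intro bounded_linear_compression) (auto simp: bounded_lipschitz_domain_def)
  have iUV: "bounded_linear iUV" and iVH: "bounded_linear iVH" and iXU: "bounded_linear iXU"
    using UVH XU by (auto simp: continuous_embedding_def)
  have iUH: "bounded_linear iUH"
    unfolding iUH_def using bounded_linear_compose[OF iVH iUV] by (simp add: o_def)
  have Jhat_eq: "Jhat v = (norm (A \<epsilon> v - f \<epsilon>))\<^sup>2 + \<tau>\<^sub>1 * (norm (B v))\<^sup>2
      + \<tau>\<^sub>2 * (norm (Q (iUH v) - Q (iYH (S v))))\<^sup>2" for v
    by (simp add: Jhat_def fine_functional_def compression_misfit_def Q_def iUH_def S_def)
  have R_eq: "R = \<tau>\<^sub>2 * (norm (Q (iUH ue) - Q (iYH (S ue))))\<^sup>2"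
    by (simp add: R_def compression_misfit_def Q_def)
  have Jhat_nonneg: "0 \<le> Jhat v" for v
    unfolding Jhat_eq using parameters by simp

  have Jhat_lim: "(\<lambda>n. Jhat (uth n)) \<longlonglongrightarrow> m"
    unfolding m_def
  proof (rule quasi_minimizers_tendsto_infimum[where \<gamma> = \<gamma> and N = nstar])
    show "cball ue r \<inter> iXU ` NN n \<subseteq> cball ue r \<inter> iXU ` NN (Suc n)" for n
      using networks(2) by blast
  qed (use Jhat_nonneg quasi_min gamma(3) in auto)

  have "m \<le> R"
  proof -
    \<comment> \<open>Density is transitive here: continuity of \<open>iXU\<close> carries the
      closure of the networks in \<open>X\<close> into the closure of their images in
      \<open>U\<close>, and \<open>X\<close> is itself dense in \<open>U\<close>.\<close>
    have "closure (iXU ` (\<Union>n. NN n)) = UNIV"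
    proof -
      have "range iXU \<subseteq> closure (iXU ` (\<Union>n. NN n))"
        using closure_bounded_linear_image_subset[OF iXU, of "\<Union>n. NN n"] networks(3) by simp
      then show ?thesis
        using closure_minimal[of "range iXU" "closure (iXU ` (\<Union>n. NN n))"] XU(2) by auto
    qed
    then have dense: "\<exists>x. x \<in> (\<Union>n. NN n) \<and> dist (iXU x) ue < e" if "0 < e" for e
      using that closure_approachable[of ue "iXU ` (\<Union>n. NN n)"] by blast
    \<comment> \<open>The bound \<open>r\<close> keeps the competitors in the ball, where they are
      admissible and the continuity assumption applies; the reciprocal forces convergence to
      \<open>ue\<close>.\<close>
    have "\<exists>xs. \<forall>k. xs k \<in> (\<Union>n. NN n) \<and> dist (iXU (xs k)) ue < min r (inverse (real (Suc k)))"
      by (intro choice allI dense) (use coarse_stability(1) in auto)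
    then obtain xs where xs: "\<And>k. xs k \<in> (\<Union>n. NN n)"
      and close: "\<And>k. dist (iXU (xs k)) ue < min r (inverse (real (Suc k)))"
      by blast
    have xs_lim: "(\<lambda>k. iXU (xs k)) \<longlonglongrightarrow> ue"
    proof (rule metric_tendsto_imp_tendsto[OF LIMSEQ_inverse_real_of_nat])
      show "\<forall>\<^sub>F k in sequentially. dist (iXU (xs k)) ue \<le> dist (inverse (real (Suc k))) 0"
        using close by (intro always_eventually allI) (simp add: less_imp_le)
    qed
    have ball: "iXU (xs k) \<in> cball ue r" for k
      using close[of k] by (simp add: dist_commute less_imp_le)
    have A_lim: "(\<lambda>k. A \<epsilon> (iXU (xs k))) \<longlonglongrightarrow> f \<epsilon>" and B_lim: "(\<lambda>k. B (iXU (xs k))) \<longlonglongrightarrow> 0"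
      using blinfun.tendsto[OF tendsto_const xs_lim, of "A \<epsilon>"]
        blinfun.tendsto[OF tendsto_const xs_lim, of B] solution by simp_all
    have "(\<lambda>k. norm (iXU (xs k) - ue)) \<longlonglongrightarrow> norm (ue - ue)"
      "(\<lambda>k. norm (A \<epsilon> (iXU (xs k)) - f \<epsilon>) + norm (B (iXU (xs k))))
        \<longlonglongrightarrow> norm (f \<epsilon> - f \<epsilon>) + norm (0 :: 'z)"
      by (intro tendsto_intros xs_lim A_lim B_lim)+
    then have "is_approximating_sequence iXU (A \<epsilon>) B (f \<epsilon>) ue xs"
      by (simp add: is_approximating_sequence_def)
    then have "weakly_converges (\<lambda>k. S (iXU (xs k))) (S ue)"
      using continuity ball by blast
    then have S_lim: "(\<lambda>k. iYH (S (iXU (xs k)))) \<longlonglongrightarrow> iYH (S ue)"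
      by (rule compact_embedding_weakly_converges[OF YH(1)])
    \<comment> \<open>Both residuals vanish in the limit because \<open>ue\<close> solves the
      fine-scale problem; only the misfit term survives.\<close>
    have "(\<lambda>k. Jhat (iXU (xs k))) \<longlonglongrightarrow> (norm (f \<epsilon> - f \<epsilon>))\<^sup>2 + \<tau>\<^sub>1 * (norm (0 :: 'z))\<^sup>2
      + \<tau>\<^sub>2 * (norm (Q (iUH ue) - Q (iYH (S ue))))\<^sup>2"
      unfolding Jhat_eq
      by (intro tendsto_intros A_lim B_lim bounded_linear.tendsto[OF Q] bounded_linear.tendsto[OF iUH]
          S_lim xs_lim)
    then have "(\<lambda>k. Jhat (iXU (xs k))) \<longlonglongrightarrow> R"
      by (simp add: R_eq)
    moreover have "m \<le> Jhat (iXU (xs k))" for k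
      unfolding m_def using xs[of k] ball[of k] Jhat_nonneg
      by (intro cINF_lower bdd_belowI[of _ 0]) auto
    ultimately show ?thesis
      by (intro LIMSEQ_le_const) auto
  qed

  have "limsup (\<lambda>n. ereal (norm (iUV (uth n - ue)))) \<le> ereal (1 / sqrt Cs * sqrt R)" if "1 \<le> \<tau>\<^sub>1"
  proof -
    \<comment> \<open>Fine-scale stability is applied to the error \<open>v - ue\<close>, whose
      images under \<open>A \<epsilon>\<close> and \<open>B\<close> are the residuals of
      \<open>v\<close>. The condition \<open>1 \<le> \<tau>\<^sub>1\<close> lets the weighted
      boundary term dominate the unweighted one.\<close>
    have bound: "norm (iUV (v - ue)) \<le> 1 / sqrt Cs * sqrt (Jhat v)" for v
    proof -
      have "Cs * (norm (iUV (v - ue)))\<^sup>2 \<le> (norm (A \<epsilon> (v - ue)))\<^sup>2 + (norm (B (v - ue)))\<^sup>2"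
        using fine_stability(3) by blast
      also have "\<dots> = (norm (A \<epsilon> v - f \<epsilon>))\<^sup>2 + 1 * (norm (B v))\<^sup>2"
        by (simp add: blinfun.diff_right solution)
      also have "\<dots> \<le> (norm (A \<epsilon> v - f \<epsilon>))\<^sup>2 + \<tau>\<^sub>1 * (norm (B v))\<^sup>2"
        using that by (intro add_left_mono mult_right_mono) auto
      also have "\<dots> \<le> Jhat v"
        unfolding Jhat_eq using parameters(3) by simp
      finally have "(norm (iUV (v - ue)))\<^sup>2 \<le> Jhat v / Cs"
        using fine_stability(1) by (simp add: field_simps)
      then have "norm (iUV (v - ue)) \<le> sqrt (Jhat v / Cs)"
        by (rule real_le_rsqrt)
      then show ?thesis
        by (simp add: real_sqrt_divide)
    qed
    \<comment> \<open>The error itself need not converge, so it is bounded through a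
      \<open>limsup\<close>; the majorant does converge, with limit given by
      \<open>m\<close>.\<close>
    have "(\<lambda>n. ereal (1 / sqrt Cs * sqrt (Jhat (uth n)))) \<longlonglongrightarrow> ereal (1 / sqrt Cs * sqrt m)"
      by (intro tendsto_intros Jhat_lim)
    then have lim: "limsup (\<lambda>n. ereal (1 / sqrt Cs * sqrt (Jhat (uth n))))
        = ereal (1 / sqrt Cs * sqrt m)"
      by (intro lim_imp_Limsup) auto
    have "limsup (\<lambda>n. ereal (norm (iUV (uth n - ue))))
        \<le> limsup (\<lambda>n. ereal (1 / sqrt Cs * sqrt (Jhat (uth n))))"
      by (intro Limsup_mono always_eventually allI) (use bound in simp)
    also have "\<dots> \<le> ereal (1 / sqrt Cs * sqrt R)"
      unfolding lim ereal_less_eq using \<open>m \<le> R\<close> fine_stability(1)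
      by (intro mult_left_mono) auto
    finally show ?thesis .
  qed
  moreover have "convergent (\<lambda>n. Jhat (uth n))" "lim (\<lambda>n. Jhat (uth n)) \<le> R"
    using Jhat_lim \<open>m \<le> R\<close> by (auto simp: convergentI limI)
  ultimately show ?thesis
    unfolding R_def by blast
qed

end
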